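(* Let $\phi = \forall x_1^{r_1} \cdots \forall x_k^{r_k} \exists y_1^{s} \cdots \exists y_l^{s}\, \theta$ be an $\mathcal{L}_{\mathrm{TST}}$-sentence, where superscripts denote the types of the variables (so all existentially quantified variables have the same type $s$) and $\theta$ is quantifier-free. Then $\mathrm{TSTI}$ decides $\phi$, i.e. $\mathrm{TSTI} \vdash \phi$ or $\mathrm{TSTI} \vdash \neg\phi$.
   Context: $\mathcal{L}_{\mathrm{TST}}$ is the many-sorted first-order language with sorts (called types) $n\in\mathbb{N}=\{0,1,2,\ldots\}$, variables $x^n,y^n,\ldots$ of each type $n$ (superscripts denote types), and a binary relation symbol $\in_n$ for each $n$. Atomic formulae have the form $x^n\in_n y^{n+1}$ or $x^n=y^n$; formulae are built with the usual connectives and quantifiers. $\mathrm{TST}$ is the $\mathcal{L}_{\mathrm{TST}}$-theory with axioms: (Extensionality) for all $n$, $\forall x^{n+1}\forall y^{n+1}(x^{n+1}=y^{n+1}\iff\forall z^n(z^n\in_n x^{n+1}\iff z^n\in_n y^{n+1}))$; (Comprehension) for all $n$ and all $\mathcal{L}_{\mathrm{TST}}$-formulae $\varphi(x^n,\vec z)$, $\forall\vec z\,\exists y^{n+1}\forall x^n(x^n\in_n y^{n+1}\iff\varphi(x^n,\vec z))$. $\mathrm{TSTI}$ is $\mathrm{TST}$ plus the axiom $\exists x^1\exists f^3(f^3:x^1\to x^1\text{ is injective but not surjective})$, where functions are sets of Wiener–Kuratowski ordered pairs (so a function between type-1 sets is an object of type 3). *)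

theory Defs
  imports Main
begin

section \<open>The many-sorted language of TST\<close>

text \<open>
  Bound variables are de Bruijn indices, counted separately for each type: in the scope of
  \<open>Forall n\<close>, the index 0 of type \<open>n\<close> is the newly bound variable, the other indices of type \<open>n\<close> are
  shifted by one, and the indices of types other than \<open>n\<close> are unaffected.
  \<open>Mem n i j\<close> says that the variable \<open>i\<close> of type \<open>n\<close> is an element of the variable \<open>j\<close> of type
  \<open>n + 1\<close>; \<open>Eq n i j\<close> equates the variables \<open>i\<close> and \<open>j\<close>, both of type \<open>n\<close>. Hence every element of
  \<open>fm\<close> is well typed.
\<close>

datatype fm =
    Mem nat nat nat
  | Eq nat nat nat
  | Falsum
  | Imp fm fm
  | Forall nat fm

definition Neg :: "fm \<Rightarrow> fm" where
  "Neg \<phi> = Imp \<phi> Falsum"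

definition Disj :: "fm \<Rightarrow> fm \<Rightarrow> fm" where
  "Disj \<phi> \<psi> = Imp (Neg \<phi>) \<psi>"

definition Conj :: "fm \<Rightarrow> fm \<Rightarrow> fm" where
  "Conj \<phi> \<psi> = Neg (Imp \<phi> (Neg \<psi>))"

definition Iff :: "fm \<Rightarrow> fm \<Rightarrow> fm" where
  "Iff \<phi> \<psi> = Conj (Imp \<phi> \<psi>) (Imp \<psi> \<phi>)"

definition Exists :: "nat \<Rightarrow> fm \<Rightarrow> fm" where
  "Exists n \<phi> = Neg (Forall n (Neg \<phi>))"

fun quantifier_free :: "fm \<Rightarrow> bool" where
  "quantifier_free (Mem n i j) = True"
| "quantifier_free (Eq n i j) = True"
| "quantifier_free Falsum = True"
| "quantifier_free (Imp \<phi> \<psi>) = (quantifier_free \<phi> \<and> quantifier_free \<psi>)"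
| "quantifier_free (Forall n \<phi>) = False"

text \<open>Free variables, as pairs of a type and an index.\<close>

fun free_vars :: "fm \<Rightarrow> (nat \<times> nat) set" where
  "free_vars (Mem n i j) = {(n, i), (Suc n, j)}"
| "free_vars (Eq n i j) = {(n, i), (n, j)}"
| "free_vars Falsum = {}"
| "free_vars (Imp \<phi> \<psi>) = free_vars \<phi> \<union> free_vars \<psi>"
| "free_vars (Forall n \<phi>) =
     {(m, i). (m, if m = n then Suc i else i) \<in> free_vars \<phi>}"

definition sentence :: "fm \<Rightarrow> bool" where
  "sentence \<phi> \<longleftrightarrow> free_vars \<phi> = {}"

text \<open>
  The terms are the variables, so substitution is renaming. A renaming \<open>\<rho>\<close> sends the variable \<open>i\<close> of
  type \<open>n\<close> to the variable \<open>\<rho> n i\<close> of the same type.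
\<close>

definition under :: "nat \<Rightarrow> (nat \<Rightarrow> nat \<Rightarrow> nat) \<Rightarrow> nat \<Rightarrow> nat \<Rightarrow> nat" where
  "under n \<rho> m i =
     (if m = n then (case i of 0 \<Rightarrow> 0 | Suc k \<Rightarrow> Suc (\<rho> n k)) else \<rho> m i)"

fun rename :: "(nat \<Rightarrow> nat \<Rightarrow> nat) \<Rightarrow> fm \<Rightarrow> fm" where
  "rename \<rho> (Mem n i j) = Mem n (\<rho> n i) (\<rho> (Suc n) j)"
| "rename \<rho> (Eq n i j) = Eq n (\<rho> n i) (\<rho> n j)"
| "rename \<rho> Falsum = Falsum"
| "rename \<rho> (Imp \<phi> \<psi>) = Imp (rename \<rho> \<phi>) (rename \<rho> \<psi>)"
| "rename \<rho> (Forall n \<phi>) = Forall n (rename (under n \<rho>) \<phi>)"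

text \<open>
  \<open>lift n \<phi>\<close> is \<open>\<phi>\<close> placed below an additional quantifier of type \<open>n\<close> whose variable it does not
  mention; \<open>inst n j \<phi>\<close> instantiates the variable bound in \<open>Forall n \<phi>\<close> by the variable \<open>j\<close>.
\<close>

definition lift :: "nat \<Rightarrow> fm \<Rightarrow> fm" where
  "lift n = rename (\<lambda>m i. if m = n then Suc i else i)"

definition inst :: "nat \<Rightarrow> nat \<Rightarrow> fm \<Rightarrow> fm" where
  "inst n j = rename (\<lambda>m i. if m = n then (case i of 0 \<Rightarrow> j | Suc k \<Rightarrow> k) else i)"


section \<open>Provability\<close>

text \<open>
  Natural deduction for classical many-sorted logic with equality. In \<open>allI\<close>, lifting the hypotheses
  expresses that the generalised variable is not free in them.
\<close>

inductive provable :: "fm set \<Rightarrow> fm \<Rightarrow> bool" (infix "\<turnstile>" 50) where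
  assm: "\<phi> \<in> \<Gamma> \<Longrightarrow> \<Gamma> \<turnstile> \<phi>"
| impI: "insert \<phi> \<Gamma> \<turnstile> \<psi> \<Longrightarrow> \<Gamma> \<turnstile> Imp \<phi> \<psi>"
| impE: "\<Gamma> \<turnstile> Imp \<phi> \<psi> \<Longrightarrow> \<Gamma> \<turnstile> \<phi> \<Longrightarrow> \<Gamma> \<turnstile> \<psi>"
| raa: "insert (Neg \<phi>) \<Gamma> \<turnstile> Falsum \<Longrightarrow> \<Gamma> \<turnstile> \<phi>"
| allI: "lift n ` \<Gamma> \<turnstile> \<phi> \<Longrightarrow> \<Gamma> \<turnstile> Forall n \<phi>"
| allE: "\<Gamma> \<turnstile> Forall n \<phi> \<Longrightarrow> \<Gamma> \<turnstile> inst n j \<phi>"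
| eqI: "\<Gamma> \<turnstile> Eq n i i"
| eqE: "\<Gamma> \<turnstile> Eq n i j \<Longrightarrow> \<Gamma> \<turnstile> inst n i \<phi> \<Longrightarrow> \<Gamma> \<turnstile> inst n j \<phi>"


section \<open>The theories TST and TSTI\<close>

definition extensionality :: "nat \<Rightarrow> fm" where
  "extensionality n =
     Forall (n + 1) (Forall (n + 1)
       (Iff (Eq (n + 1) 1 0) (Forall n (Iff (Mem n 0 1) (Mem n 0 0)))))"

text \<open>
  In the comprehension instance for \<open>\<phi>\<close>, the variable 0 of type \<open>n\<close> plays the role of the
  comprehended variable and all other free variables of \<open>\<phi>\<close> are parameters. The lifting ensures that
  the set asserted to exist is not itself a parameter. The axioms are the universal closures of these
  instances.
\<close>

definition comprehension :: "nat \<Rightarrow> fm \<Rightarrow> fm" where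
  "comprehension n \<phi> =
     Exists (n + 1) (Forall n (Iff (Mem n 0 0) (lift (n + 1) \<phi>)))"

definition TST :: "fm set" where
  "TST = range extensionality \<union>
     {foldr Forall ts (comprehension n \<phi>) | ts n \<phi>.
        sentence (foldr Forall ts (comprehension n \<phi>))}"

text \<open>
  Wiener--Kuratowski pairs. The arguments \<open>a\<close> and \<open>b\<close> are variables of type \<open>n\<close>, whereas \<open>u\<close>, \<open>x\<close> and
  \<open>y\<close> are of type \<open>n + 1\<close>, \<open>p\<close> is of type \<open>n + 2\<close> and \<open>f\<close> is of type \<open>n + 3\<close>.
\<close>

definition is_singleton_fm :: "nat \<Rightarrow> nat \<Rightarrow> nat \<Rightarrow> fm" where
  "is_singleton_fm n u a = Forall n (Iff (Mem n 0 u) (Eq n 0 (a + 1)))"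

definition is_upair_fm :: "nat \<Rightarrow> nat \<Rightarrow> nat \<Rightarrow> nat \<Rightarrow> fm" where
  "is_upair_fm n u a b =
     Forall n (Iff (Mem n 0 u) (Disj (Eq n 0 (a + 1)) (Eq n 0 (b + 1))))"

definition is_pair_fm :: "nat \<Rightarrow> nat \<Rightarrow> nat \<Rightarrow> nat \<Rightarrow> fm" where
  "is_pair_fm n p a b =
     Forall (n + 1)
       (Iff (Mem (n + 1) 0 p) (Disj (is_singleton_fm n 0 a) (is_upair_fm n 0 a b)))"

definition maps_to_fm :: "nat \<Rightarrow> nat \<Rightarrow> nat \<Rightarrow> nat \<Rightarrow> fm" where
  "maps_to_fm n f a b = Exists (n + 2) (Conj (is_pair_fm n 0 a b) (Mem (n + 2) 0 f))"

definition function_fm :: "nat \<Rightarrow> nat \<Rightarrow> nat \<Rightarrow> nat \<Rightarrow> fm" where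
  "function_fm n f x y =
     Conj
       (Forall (n + 2) (Imp (Mem (n + 2) 0 f)
          (Exists n (Exists n
             (Conj (Conj (Mem n 1 x) (Mem n 0 y)) (is_pair_fm n 0 1 0))))))
       (Forall n (Imp (Mem n 0 x)
          (Exists n (Conj (maps_to_fm n f 1 0)
             (Forall n (Imp (maps_to_fm n f 2 0) (Eq n 0 1)))))))"

definition injective_fm :: "nat \<Rightarrow> nat \<Rightarrow> fm" where
  "injective_fm n f =
     Forall n (Forall n (Forall n
       (Imp (Conj (maps_to_fm n f 2 0) (maps_to_fm n f 1 0)) (Eq n 2 1))))"

definition surjective_fm :: "nat \<Rightarrow> nat \<Rightarrow> nat \<Rightarrow> fm" where
  "surjective_fm n f y = Forall n (Imp (Mem n 0 y) (Exists n (maps_to_fm n f 0 1)))"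

definition infinity :: fm where
  "infinity =
     Exists 1 (Exists 3
       (Conj (function_fm 0 0 0 0) (Conj (injective_fm 0 0) (Neg (surjective_fm 0 0 0)))))"

definition TSTI :: "fm set" where
  "TSTI = insert infinity TST"

end

theory Submission
  imports Defs "HOL-Library.Countable_Set"
begin

text \<open>
  If TSTI decided neither \<open>\<phi>\<close> nor its negation, then, by the completeness of first-order logic, there
  would be countable models \<open>M\<close> of TSTI and \<open>\<phi>\<close>, and \<open>N\<close> of TSTI and the negation of \<open>\<phi>\<close>. So it has
  to be shown that, if every assignment of values in \<open>M\<close> to the variables \<open>x\<close> admits witnesses
  \<open>y\<close> of type \<open>s\<close> with \<open>\<theta>\<close>, then the same is true in \<open>N\<close>.

  The values of the variables \<open>x\<close> in \<open>N\<close> form finite sets \<open>X n\<close> of elements of the types \<open>n\<close>. They are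
  copied into \<open>M\<close>, type by type, by injections \<open>h n\<close> from \<open>X n\<close> to the objects of type \<open>n\<close> of \<open>M\<close>. This
  is done together with injections \<open>g n\<close> in the other direction, which map the whole type \<open>n\<close> of \<open>M\<close>
  into the type \<open>n\<close> of \<open>N\<close>, are left inverse to \<open>h n\<close>, and preserve and reflect membership towards the
  copied elements of both adjacent types. Witnesses \<open>y\<close> of type \<open>s\<close> for the copied values can then be
  moved from \<open>M\<close> to \<open>N\<close> by \<open>g s\<close>: as all of them have the same type, a quantifier-free formula relates
  them to each other only by equations, and to the values of \<open>x\<close> only by equations and by membership
  in adjacent types (\<open>existential_transfer\<close>). This is where the restriction on the prefix enters.

  The step from one type to the next is \<open>ex_next_level\<close>. Call the set of those elements of \<open>X (n - 1)\<close>
  that belong to an object of type \<open>n\<close> its trace. In both models each possible trace is shared by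
  infinitely many objects, because every type is infinite. Hence \<open>g n\<close> can be chosen among the
  injections that respect traces. The copy of \<open>A\<close> in \<open>X (n + 1)\<close> has to be the preimage of \<open>A\<close> under
  \<open>g n\<close>, so these preimages must be sets of \<open>M\<close>. They are, if within each trace they are finite or
  cofinite; and by the pigeonhole principle one can arrange that almost all objects with a given
  trace are mapped into one single cell of the partition that the finitely many sets \<open>A\<close> generate.
  This is \<open>one_colour_injection\<close>, where the countability of the models is used.
\<close>


section \<open>Renaming variables\<close>

definition shift :: "nat \<Rightarrow> 'a \<Rightarrow> (nat \<Rightarrow> nat \<Rightarrow> 'a) \<Rightarrow> nat \<Rightarrow> nat \<Rightarrow> 'a" where
  "shift n a v = v(n := case_nat a (v n))"

lemma shift_simps [simp]:
  "shift n a v n 0 = a"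
  "shift n a v n (Suc i) = v n i"
  "m \<noteq> n \<Longrightarrow> shift n a v m i = v m i"
  by (simp_all add: shift_def)

lemma under_simps [simp]:
  "under n \<rho> n 0 = 0"
  "under n \<rho> n (Suc i) = Suc (\<rho> n i)"
  "m \<noteq> n \<Longrightarrow> under n \<rho> m i = \<rho> m i"
  by (simp_all add: under_def)

lemma rename_cong:
  "(\<And>n i. (n, i) \<in> free_vars \<phi> \<Longrightarrow> \<rho> n i = \<sigma> n i) \<Longrightarrow> rename \<rho> \<phi> = rename \<sigma> \<phi>"
proof (induction \<phi> arbitrary: \<rho> \<sigma>)
  case (Forall n \<phi>)
  have "under n \<rho> m i = under n \<sigma> m i" if "(m, i) \<in> free_vars \<phi>" for m i
  proof (cases "m = n \<and> i = 0")
    case False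
    then have "(m, if m = n then i - 1 else i) \<in> free_vars (Forall n \<phi>)"
      using that by auto
    from Forall.prems[OF this] False show ?thesis
      by (auto simp: under_def split: nat.split)
  qed auto
  then have "rename (under n \<rho>) \<phi> = rename (under n \<sigma>) \<phi>"
    by (rule Forall.IH)
  then show ?case by simp
next
  case (Imp \<phi> \<psi>)
  from Imp.IH[of \<rho> \<sigma>] Imp.prems show ?case by auto
qed auto

lemma rename_rename: "rename \<rho> (rename \<sigma> \<phi>) = rename (\<lambda>n i. \<rho> n (\<sigma> n i)) \<phi>"
proof (induction \<phi> arbitrary: \<rho> \<sigma>)
  case (Forall n \<phi>)
  have "(\<lambda>m i. under n \<rho> m (under n \<sigma> m i)) = under n (\<lambda>m i. \<rho> m (\<sigma> m i))"
    by (auto simp: fun_eq_iff under_def split: nat.split)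
  then show ?case using Forall by simp
qed auto

lemma rename_ident [simp]: "rename (\<lambda>n i. i) \<phi> = \<phi>"
proof (induction \<phi>)
  case (Forall n \<phi>)
  have "under n (\<lambda>m i. i) = (\<lambda>m i. i)"
    by (auto simp: fun_eq_iff under_def split: nat.split)
  then show ?case using Forall by simp
qed auto

lemma rename_lift: "rename (under n \<rho>) (lift n \<phi>) = lift n (rename \<rho> \<phi>)"
  unfolding lift_def rename_rename by (rule rename_cong) (simp add: under_def)

lemma rename_inst: "rename \<rho> (inst n j \<phi>) = inst n (\<rho> n j) (rename (under n \<rho>) \<phi>)"
  unfolding inst_def rename_rename by (rule rename_cong) (auto simp: under_def split: nat.split)

lemma finite_free_vars [simp]: "finite (free_vars \<phi>)"
proof (induction \<phi>)
  case (Forall n \<phi>)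
  have "inj (\<lambda>(m, i). (m, if m = n then Suc i else i) :: nat \<times> nat)"
    by (auto simp: inj_def split: if_splits)
  from finite_vimageI[OF Forall this] show ?case
    by (simp add: vimage_def case_prod_unfold)
qed auto

lemma free_vars_Forall_funpow:
  "free_vars ((Forall n ^^ k) \<phi>) =
     {(m, i). (m, if m = n then i + k else i) \<in> free_vars \<phi>}"
  by (induction k) (auto split: if_splits)

text \<open>The free variables of a given type have indices below some \<open>k\<close>, so \<open>k\<close> quantifiers of that type
  bind all of them, and only finitely many types occur.\<close>

lemma ex_universal_closure: "\<exists>ts. sentence (foldr Forall ts \<phi>)"
proof -
  have *: "\<exists>ts. free_vars (foldr Forall ts \<phi>) = {p \<in> free_vars \<phi>. fst p \<notin> N}"
    if "finite N" for N :: "nat set"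
    using that
  proof induction
    case empty
    have "free_vars (foldr Forall [] \<phi>) = {p \<in> free_vars \<phi>. fst p \<notin> {}}" by simp
    then show ?case by blast
  next
    case (insert n N)
    then obtain ts where ts: "free_vars (foldr Forall ts \<phi>) = {p \<in> free_vars \<phi>. fst p \<notin> N}"
      by blast
    have "finite (snd ` free_vars \<phi>)" by simp
    then obtain k where k: "\<forall>i \<in> snd ` free_vars \<phi>. i < k"
      unfolding finite_nat_set_iff_bounded by blast
    have "(n, i + k) \<notin> free_vars \<phi>" for i
    proof
      assume "(n, i + k) \<in> free_vars \<phi>"
      from bspec[OF k imageI[OF this]] show False by simp
    qed
    then have "free_vars (foldr Forall (replicate k n @ ts) \<phi>)
        = {p \<in> free_vars \<phi>. fst p \<notin> insert n N}"
      by (auto simp: free_vars_Forall_funpow ts split: if_splits)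
    then show ?case by blast
  qed
  have "finite (fst ` free_vars \<phi>)" by simp
  from *[OF this] show ?thesis
    unfolding sentence_def by auto
qed


section \<open>Henkin sets\<close>

lemma provable_mono: "\<Gamma> \<turnstile> \<phi> \<Longrightarrow> \<Gamma> \<subseteq> \<Delta> \<Longrightarrow> \<Delta> \<turnstile> \<phi>"
proof (induction arbitrary: \<Delta> rule: provable.induct)
  case (impI \<phi> \<Gamma> \<psi>)
  then show ?case by (meson insert_mono provable.impI)
next
  case (raa \<phi> \<Gamma>)
  then show ?case by (meson insert_mono provable.raa)
next
  case (allI n \<Gamma> \<phi>)
  then show ?case by (meson image_mono provable.allI)
qed (blast intro: provable.intros)+

lemma provable_rename: "\<Gamma> \<turnstile> \<phi> \<Longrightarrow> rename \<rho> ` \<Gamma> \<turnstile> rename \<rho> \<phi>"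
proof (induction arbitrary: \<rho> rule: provable.induct)
  case (assm \<phi> \<Gamma>)
  then show ?case by (auto intro: provable.assm)
next
  case (impI \<phi> \<Gamma> \<psi>)
  then show ?case by (auto intro: provable.impI)
next
  case (impE \<Gamma> \<phi> \<psi>)
  then show ?case by (auto intro: provable.impE)
next
  case (raa \<phi> \<Gamma>)
  then show ?case by (auto intro: provable.raa simp: Neg_def)
next
  case (allI n \<Gamma> \<phi>)
  have "rename (under n \<rho>) ` lift n ` \<Gamma> = lift n ` rename \<rho> ` \<Gamma>"
    by (simp add: image_image rename_lift)
  then show ?case using allI.IH[of "under n \<rho>"] by (auto intro: provable.allI)
next
  case (allE \<Gamma> n \<phi> j)
  then show ?case by (auto simp: rename_inst intro: provable.allE)
next
  case (eqI \<Gamma> n i)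
  then show ?case by (auto intro: provable.eqI)
next
  case (eqE \<Gamma> n i j \<phi>)
  then show ?case by (simp add: rename_inst) (blast intro: provable.eqE)
qed

lemma provable_Falsum: "\<Gamma> \<turnstile> Falsum \<Longrightarrow> \<Gamma> \<turnstile> \<phi>"
  by (rule provable.raa) (blast intro: provable_mono)

lemma provable_Neg_iff: "\<Gamma> \<turnstile> Neg \<phi> \<longleftrightarrow> insert \<phi> \<Gamma> \<turnstile> Falsum"
proof
  assume "\<Gamma> \<turnstile> Neg \<phi>"
  then have "insert \<phi> \<Gamma> \<turnstile> Imp \<phi> Falsum"
    unfolding Neg_def by (blast intro: provable_mono)
  then show "insert \<phi> \<Gamma> \<turnstile> Falsum"
    by (rule provable.impE) (simp add: provable.assm)
qed (simp add: Neg_def provable.impI)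

text \<open>Generalisation over a fresh variable \<open>j\<close>: the renaming that sends \<open>j\<close> to the index \<open>0\<close> and
  raises all other indices of its type turns the hypotheses into their lifts, and it undoes the
  instantiation.\<close>

lemma provable_generalize:
  assumes inst: "\<Delta> \<turnstile> inst n j \<psi>"
    and fresh: "\<And>\<phi>. \<phi> \<in> insert (Forall n \<psi>) \<Delta> \<Longrightarrow> (n, j) \<notin> free_vars \<phi>"
  shows "\<Delta> \<turnstile> Forall n \<psi>"
proof (rule provable.allI)
  define \<rho> :: "nat \<Rightarrow> nat \<Rightarrow> nat" where
    "\<rho> m i = (if m = n then if i = j then 0 else Suc i else i)" for m i
  have "rename \<rho> \<phi> = lift n \<phi>" if "\<phi> \<in> \<Delta>" for \<phi>
    unfolding lift_def by (rule rename_cong) (use fresh that in \<open>auto simp: \<rho>_def\<close>)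
  then have "rename \<rho> ` \<Delta> = lift n ` \<Delta>"
    by (rule image_cong[OF refl])
  moreover have "rename \<rho> (inst n j \<psi>) = rename (\<lambda>n i. i) \<psi>"
    unfolding inst_def rename_rename
    by (rule rename_cong) (use fresh[of "Forall n \<psi>"] in \<open>auto simp: \<rho>_def split: nat.split\<close>)
  ultimately show "lift n ` \<Delta> \<turnstile> \<psi>"
    using provable_rename[OF inst, of \<rho>] by simp
qed

text \<open>One step of Henkin's construction. The witness for a refuted universal formula is a variable,
  and a fresh one exists because only finitely many formulas with free variables are present.\<close>

lemma henkin_step:
  assumes \<Gamma>: "\<forall>\<phi> \<in> \<Gamma>. sentence \<phi>"
    and F: "finite F" and con: "\<not> \<Gamma> \<union> F \<turnstile> Falsum"
  shows "\<exists>F'. finite F' \<and> F \<subseteq> F' \<and> \<not> \<Gamma> \<union> F' \<turnstile> Falsum \<and>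
    (\<Gamma> \<union> F' \<turnstile> \<chi> \<or>
     \<Gamma> \<union> F' \<turnstile> Neg \<chi> \<and> (\<forall>n \<psi>. \<chi> = Forall n \<psi> \<longrightarrow> (\<exists>j. \<Gamma> \<union> F' \<turnstile> Neg (inst n j \<psi>))))"
proof (cases "\<Gamma> \<union> F \<turnstile> \<chi>")
  case True
  then show ?thesis using F con by blast
next
  case False
  define G where "G = insert (Neg \<chi>) F"
  have G: "finite G" "F \<subseteq> G" "Neg \<chi> \<in> G" "\<not> \<Gamma> \<union> G \<turnstile> Falsum"
    using F False provable.raa[of \<chi> "\<Gamma> \<union> F"] by (auto simp: G_def)
  show ?thesis
  proof (cases "\<exists>n \<psi>. \<chi> = Forall n \<psi>")
    case False
    then show ?thesis
      using G by (intro exI[of _ G]) (auto intro: provable.assm)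
  next
    case True
    then obtain n \<psi> where \<chi>: "\<chi> = Forall n \<psi>" by blast
    have "finite (snd ` (\<Union>\<phi> \<in> insert \<chi> G. free_vars \<phi>))"
      using G by simp
    then obtain j where j: "j \<notin> snd ` (\<Union>\<phi> \<in> insert \<chi> G. free_vars \<phi>)"
      using ex_new_if_finite[OF infinite_UNIV_nat] by blast
    have fresh: "(n, j) \<notin> free_vars \<phi>" if "\<phi> \<in> insert \<chi> (\<Gamma> \<union> G)" for \<phi>
    proof (cases "\<phi> \<in> \<Gamma>")
      case True
      then show ?thesis using \<Gamma> by (simp add: sentence_def)
    next
      case False
      then show ?thesis using that j by force
    qed
    have "\<not> \<Gamma> \<union> G \<turnstile> inst n j \<psi>"
    proof
      assume "\<Gamma> \<union> G \<turnstile> inst n j \<psi>"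
      then have "\<Gamma> \<union> G \<turnstile> \<chi>"
        unfolding \<chi> by (rule provable_generalize) (use fresh in \<open>simp add: \<chi>\<close>)
      moreover have "\<Gamma> \<union> G \<turnstile> Imp \<chi> Falsum"
        using G(3) by (auto intro: provable.assm simp: Neg_def)
      ultimately show False
        using G(4) provable.impE by blast
    qed
    then have "\<not> \<Gamma> \<union> insert (Neg (inst n j \<psi>)) G \<turnstile> Falsum"
      using provable.raa[of "inst n j \<psi>" "\<Gamma> \<union> G"] by auto
    then show ?thesis
      using G \<chi> by (intro exI[of _ "insert (Neg (inst n j \<psi>)) G"]) (auto intro: provable.assm)
  qed
qed

instance fm :: countable
  by countable_datatype

text \<open>The set \<open>H\<close> consists of everything that is provable at some stage of the construction. Since the
  stages increase, any two of its members are provable at a common stage.\<close>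

lemma henkin_set:
  assumes \<Gamma>: "\<forall>\<phi> \<in> \<Gamma>. sentence \<phi>" and con: "\<not> \<Gamma> \<turnstile> Falsum"
  obtains H where "\<Gamma> \<subseteq> H" "Falsum \<notin> H"
    "\<And>\<phi> \<psi>. Imp \<phi> \<psi> \<in> H \<longleftrightarrow> (\<phi> \<in> H \<longrightarrow> \<psi> \<in> H)"
    "\<And>n \<phi>. Forall n \<phi> \<in> H \<longleftrightarrow> (\<forall>j. inst n j \<phi> \<in> H)"
    "\<And>n i. Eq n i i \<in> H"
    "\<And>n i j \<phi>. Eq n i j \<in> H \<Longrightarrow> inst n i \<phi> \<in> H \<Longrightarrow> inst n j \<phi> \<in> H"
proof -
  define dec where "dec F \<chi> \<longleftrightarrow> \<Gamma> \<union> F \<turnstile> \<chi> \<or>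
     \<Gamma> \<union> F \<turnstile> Neg \<chi> \<and> (\<forall>n \<psi>. \<chi> = Forall n \<psi> \<longrightarrow> (\<exists>j. \<Gamma> \<union> F \<turnstile> Neg (inst n j \<psi>)))" for F \<chi>
  have "\<exists>F. \<forall>k. (finite (F k) \<and> \<not> \<Gamma> \<union> F k \<turnstile> Falsum) \<and>
      (F k \<subseteq> F (Suc k) \<and> dec (F (Suc k)) (from_nat k))"
  proof (rule dependent_nat_choice)
    show "\<exists>F. finite F \<and> \<not> \<Gamma> \<union> F \<turnstile> Falsum"
      using con by (intro exI[of _ "{}"]) simp
  next
    fix F :: "fm set" and k :: nat
    assume "finite F \<and> \<not> \<Gamma> \<union> F \<turnstile> Falsum"
    then have "\<exists>F'. finite F' \<and> F \<subseteq> F' \<and> \<not> \<Gamma> \<union> F' \<turnstile> Falsum \<and> dec F' (from_nat k)"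
      unfolding dec_def by (intro henkin_step \<Gamma>) auto
    then show "\<exists>F'. (finite F' \<and> \<not> \<Gamma> \<union> F' \<turnstile> Falsum) \<and> (F \<subseteq> F' \<and> dec F' (from_nat k))"
      by blast
  qed
  then obtain F where con: "\<And>k. \<not> \<Gamma> \<union> F k \<turnstile> Falsum"
    and step: "\<And>k. F k \<subseteq> F (Suc k)" and dec: "\<And>k. dec (F (Suc k)) (from_nat k)"
    by blast
  define H where "H = {\<phi>. \<exists>k. \<Gamma> \<union> F k \<turnstile> \<phi>}"
  have mono: "\<Gamma> \<union> F l \<turnstile> \<phi>" if "\<Gamma> \<union> F k \<turnstile> \<phi>" "k \<le> l" for k l \<phi>
    by (rule provable_mono[OF that(1)]) (use lift_Suc_mono_le[of F, OF step that(2)] in blast)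
  have common: "\<exists>k. \<Gamma> \<union> F k \<turnstile> \<phi> \<and> \<Gamma> \<union> F k \<turnstile> \<psi>" if in_H: "\<phi> \<in> H" "\<psi> \<in> H" for \<phi> \<psi>
  proof -
    obtain k l where "\<Gamma> \<union> F k \<turnstile> \<phi>" "\<Gamma> \<union> F l \<turnstile> \<psi>"
      using in_H by (auto simp: H_def)
    then have "\<Gamma> \<union> F (max k l) \<turnstile> \<phi>" "\<Gamma> \<union> F (max k l) \<turnstile> \<psi>"
      by (auto intro: mono)
    then show ?thesis by blast
  qed
  have Falsum: "Falsum \<notin> H"
    using con by (simp add: H_def)
  have mp: "\<psi> \<in> H" if "Imp \<phi> \<psi> \<in> H" "\<phi> \<in> H" for \<phi> \<psi>
    using common[OF that] unfolding H_def by (blast intro: provable.impE)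
  have closed: "\<psi> \<in> H" if "\<phi> \<in> H" "\<And>\<Delta>. \<Delta> \<turnstile> \<phi> \<Longrightarrow> \<Delta> \<turnstile> \<psi>" for \<phi> \<psi>
    using that unfolding H_def by blast
  have complete: "\<phi> \<in> H \<or> Neg \<phi> \<in> H \<and> (\<forall>n \<psi>. \<phi> = Forall n \<psi> \<longrightarrow> (\<exists>j. Neg (inst n j \<psi>) \<in> H))" for \<phi>
    using dec[of "to_nat \<phi>"] unfolding H_def dec_def by auto
  have not_both: "\<not> (\<phi> \<in> H \<and> Neg \<phi> \<in> H)" for \<phi>
    using mp Falsum unfolding Neg_def by blast
  show thesis
  proof (rule that)
    show "\<Gamma> \<subseteq> H"
      unfolding H_def by (auto intro: provable.assm)
    show "Imp \<phi> \<psi> \<in> H \<longleftrightarrow> (\<phi> \<in> H \<longrightarrow> \<psi> \<in> H)" for \<phi> \<psi>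
    proof
      assume *: "\<phi> \<in> H \<longrightarrow> \<psi> \<in> H"
      show "Imp \<phi> \<psi> \<in> H"
      proof (cases "\<phi> \<in> H")
        case True
        with * have "\<psi> \<in> H" by blast
        then show ?thesis
          by (rule closed) (blast intro: provable.impI provable_mono)
      next
        case False
        then have "Neg \<phi> \<in> H" using complete by blast
        then show ?thesis
          by (rule closed) (simp add: provable_Neg_iff provable.impI provable_Falsum)
      qed
    qed (use mp in blast)
    show "Forall n \<phi> \<in> H \<longleftrightarrow> (\<forall>j. inst n j \<phi> \<in> H)" for n \<phi>
    proof
      assume "Forall n \<phi> \<in> H"
      then show "\<forall>j. inst n j \<phi> \<in> H"
        by (auto intro: closed provable.allE)
    next
      assume "\<forall>j. inst n j \<phi> \<in> H"
      then show "Forall n \<phi> \<in> H"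
        using complete[of "Forall n \<phi>"] not_both by blast
    qed
    show "Eq n i i \<in> H" for n i
      unfolding H_def by (auto intro: provable.eqI)
    show "inst n j \<phi> \<in> H" if "Eq n i j \<in> H" "inst n i \<phi> \<in> H" for n i j \<phi>
      using common[OF that] unfolding H_def by (blast intro: provable.eqE)
  qed (fact Falsum)
qed


section \<open>Validity and term models\<close>

fun sat :: "(nat \<Rightarrow> 'a set) \<Rightarrow> (nat \<Rightarrow> 'a \<Rightarrow> 'a \<Rightarrow> bool) \<Rightarrow> (nat \<Rightarrow> nat \<Rightarrow> 'a) \<Rightarrow> fm \<Rightarrow> bool" where
  "sat D E v (Mem n i j) = E n (v n i) (v (Suc n) j)"
| "sat D E v (Eq n i j) = (v n i = v n j)"
| "sat D E v Falsum = False"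
| "sat D E v (Imp \<phi> \<psi>) = (sat D E v \<phi> \<longrightarrow> sat D E v \<psi>)"
| "sat D E v (Forall n \<phi>) = (\<forall>a \<in> D n. sat D E (shift n a v) \<phi>)"

lemma sat_connectives [simp]:
  "sat D E v (Neg \<phi>) = (\<not> sat D E v \<phi>)"
  "sat D E v (Disj \<phi> \<psi>) = (sat D E v \<phi> \<or> sat D E v \<psi>)"
  "sat D E v (Conj \<phi> \<psi>) = (sat D E v \<phi> \<and> sat D E v \<psi>)"
  "sat D E v (Iff \<phi> \<psi>) = (sat D E v \<phi> = sat D E v \<psi>)"
  "sat D E v (Exists n \<phi>) = (\<exists>a \<in> D n. sat D E (shift n a v) \<phi>)"
  by (auto simp: Neg_def Disj_def Conj_def Iff_def Exists_def)

lemma sat_cong: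
  "(\<And>n i. (n, i) \<in> free_vars \<phi> \<Longrightarrow> v n i = w n i) \<Longrightarrow> sat D E v \<phi> = sat D E w \<phi>"
proof (induction \<phi> arbitrary: v w)
  case (Forall n \<phi>)
  have "shift n a v m i = shift n a w m i" if "(m, i) \<in> free_vars \<phi>" for m i a
  proof (cases "m = n \<and> i = 0")
    case False
    then have "(m, if m = n then i - 1 else i) \<in> free_vars (Forall n \<phi>)"
      using that by auto
    from Forall.prems[OF this] False show ?thesis
      by (auto simp: shift_def split: nat.split)
  qed auto
  then have "sat D E (shift n a v) \<phi> = sat D E (shift n a w) \<phi>" for a
    by (rule Forall.IH)
  then show ?case by simp
next
  case (Imp \<phi> \<psi>)
  have "sat D E v \<phi> = sat D E w \<phi>" "sat D E v \<psi> = sat D E w \<psi>"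
    using Imp.prems by (intro Imp.IH; simp)+
  then show ?case by simp
qed auto

lemma sat_rename: "sat D E v (rename \<rho> \<phi>) = sat D E (\<lambda>n i. v n (\<rho> n i)) \<phi>"
proof (induction \<phi> arbitrary: v \<rho>)
  case (Forall n \<phi>)
  have "(\<lambda>m i. shift n a v m (under n \<rho> m i)) = shift n a (\<lambda>m i. v m (\<rho> m i))" for a
    by (auto simp: fun_eq_iff shift_def under_def split: nat.split)
  then show ?case using Forall by simp
qed auto

definition valuations :: "(nat \<Rightarrow> 'a set) \<Rightarrow> (nat \<Rightarrow> nat \<Rightarrow> 'a) set" where
  "valuations D = {v. \<forall>n i. v n i \<in> D n}"

lemma valuations_nonempty:
  assumes "\<And>n. D n \<noteq> {}"
  shows "\<exists>v. v \<in> valuations D"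
proof -
  have "(\<lambda>n i. SOME a. a \<in> D n) \<in> valuations D"
    using assms by (simp add: valuations_def some_in_eq)
  then show ?thesis by blast
qed

lemma shift_in_valuations: "a \<in> D n \<Longrightarrow> v \<in> valuations D \<Longrightarrow> shift n a v \<in> valuations D"
  by (auto simp: valuations_def shift_def split: nat.split)

text \<open>Every valuation arises from another one by a shift, so leading universal quantifiers do not
  affect validity. This serves to unpack the universal closures among the axioms, and to strip the
  prefix of universal quantifiers of a sentence.\<close>

lemma valid_Forall:
  "(\<forall>v \<in> valuations D. sat D E v (Forall n \<phi>)) \<longleftrightarrow> (\<forall>v \<in> valuations D. sat D E v \<phi>)"
proof
  assume *: "\<forall>v \<in> valuations D. sat D E v (Forall n \<phi>)"
  show "\<forall>v \<in> valuations D. sat D E v \<phi>"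
  proof
    fix v assume v: "v \<in> valuations D"
    let ?w = "\<lambda>m i. v m (if m = n then Suc i else i)"
    have eq: "shift n (v n 0) ?w = v"
      by (auto simp: fun_eq_iff shift_def split: nat.split)
    have w: "?w \<in> valuations D" and v0: "v n 0 \<in> D n"
      using v by (auto simp: valuations_def)
    have "\<forall>a \<in> D n. sat D E (shift n a ?w) \<phi>"
      using bspec[OF * w] by simp
    from bspec[OF this v0] show "sat D E v \<phi>"
      unfolding eq .
  qed
qed (auto intro: shift_in_valuations)

lemma valid_foldr_Forall:
  "(\<forall>v \<in> valuations D. sat D E v (foldr Forall ts \<phi>)) \<longleftrightarrow> (\<forall>v \<in> valuations D. sat D E v \<phi>)"
proof (induction ts)
  case (Cons t ts)
  then show ?case using valid_Forall[of D E t "foldr Forall ts \<phi>"] by simp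
qed simp

text \<open>The elements of the term model of a Henkin set are the least members of the classes of variables
  that the set equates; so it is a model on natural numbers, and in particular countable.\<close>

theorem model_existence:
  assumes \<Gamma>: "\<forall>\<phi> \<in> \<Gamma>. sentence \<phi>" and con: "\<not> \<Gamma> \<turnstile> Falsum"
  obtains D :: "nat \<Rightarrow> nat set" and E where "\<And>n. D n \<noteq> {}"
    "\<And>\<phi> v. \<phi> \<in> \<Gamma> \<Longrightarrow> sat D E v \<phi>"
proof -
  obtain H where H: "\<Gamma> \<subseteq> H" "Falsum \<notin> H"
    "\<And>\<phi> \<psi>. Imp \<phi> \<psi> \<in> H \<longleftrightarrow> (\<phi> \<in> H \<longrightarrow> \<psi> \<in> H)"
    "\<And>n \<phi>. Forall n \<phi> \<in> H \<longleftrightarrow> (\<forall>j. inst n j \<phi> \<in> H)"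
    and refl: "\<And>n i. Eq n i i \<in> H"
    and subst: "\<And>n i j \<phi>. Eq n i j \<in> H \<Longrightarrow> inst n i \<phi> \<in> H \<Longrightarrow> inst n j \<phi> \<in> H"
    by (rule henkin_set[OF \<Gamma> con]) (rule that)
  have sym: "Eq n j i \<in> H" if "Eq n i j \<in> H" for n i j
    using subst[OF that, of "Eq n 0 (Suc i)"] refl by (simp add: inst_def)
  have trans: "Eq n i k \<in> H" if "Eq n i j \<in> H" "Eq n j k \<in> H" for n i j k
    using subst[OF that(2), of "Eq n (Suc i) 0"] that(1) by (simp add: inst_def)
  define r :: "nat \<Rightarrow> nat \<Rightarrow> nat" where "r n i = (LEAST j. Eq n i j \<in> H)" for n i
  define D where "D n = range (r n)" for n
  define E where "E n i j \<longleftrightarrow> Mem n i j \<in> H" for n i j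
  have r: "Eq n i (r n i) \<in> H" for n i
    unfolding r_def using refl by (rule LeastI)
  have r_eq: "r n i = r n j \<longleftrightarrow> Eq n i j \<in> H" for n i j
  proof
    assume "Eq n i j \<in> H"
    then have "Eq n i k \<in> H \<longleftrightarrow> Eq n j k \<in> H" for k
      using sym trans by blast
    then show "r n i = r n j" by (simp add: r_def)
  next
    assume "r n i = r n j"
    then show "Eq n i j \<in> H"
      using r[of n i] r[of n j] sym trans by metis
  qed
  have Mem_subst: "Mem n i' j' \<in> H"
    if "Mem n i j \<in> H" "Eq n i i' \<in> H" "Eq (Suc n) j j' \<in> H" for n i j i' j'
  proof -
    have "Mem n i' j \<in> H"
      using subst[OF that(2), of "Mem n 0 j"] that(1) by (simp add: inst_def)
    then show ?thesis
      using subst[OF that(3), of "Mem n i' 0"] by (simp add: inst_def)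
  qed
  have r_Mem: "E n (r n i) (r (Suc n) j) \<longleftrightarrow> Mem n i j \<in> H" for n i j
    unfolding E_def using Mem_subst r sym by blast
  (* The induction has to be over all renamings of the formula: the instances of a universal
     formula are renamings of its body, not subformulas of it. *)
  have truth: "sat D E (\<lambda>n i. r n (\<rho> n i)) \<phi> \<longleftrightarrow> rename \<rho> \<phi> \<in> H" for \<phi> \<rho>
  proof (induction \<phi> arbitrary: \<rho>)
    case (Forall n \<phi>)
    have "shift n (r n j) (\<lambda>m i. r m (\<rho> m i)) = (\<lambda>m i. r m (shift n j \<rho> m i))" for j
      by (auto simp: fun_eq_iff shift_def split: nat.split)
    moreover have "inst n j (rename (under n \<rho>) \<phi>) = rename (shift n j \<rho>) \<phi>" for j
      unfolding inst_def rename_rename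
      by (rule rename_cong) (auto simp: shift_def under_def split: nat.split)
    moreover have "(\<forall>a \<in> D n. Q a) \<longleftrightarrow> (\<forall>j. Q (r n j))" for Q
      by (simp add: D_def)
    ultimately show ?case
      by (simp add: H Forall)
  qed (simp_all add: H r_Mem r_eq)
  have "sat D E v \<phi>" if "\<phi> \<in> \<Gamma>" for \<phi> v
  proof -
    have "sat D E v \<phi> = sat D E r \<phi>"
      by (rule sat_cong) (use \<Gamma> that in \<open>simp add: sentence_def\<close>)
    then show ?thesis
      using truth[of "\<lambda>n i. i" \<phi>] that H(1) by auto
  qed
  moreover have "D n \<noteq> {}" for n by (simp add: D_def)
  ultimately show thesis using that by blast
qed


section \<open>Sets in a model of TST\<close>

locale tst_model =
  fixes D :: "nat \<Rightarrow> 'a set" and E :: "nat \<Rightarrow> 'a \<Rightarrow> 'a \<Rightarrow> bool"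
  assumes nonempty: "D n \<noteq> {}"
    and sat_TST: "\<phi> \<in> TST \<Longrightarrow> v \<in> valuations D \<Longrightarrow> sat D E v \<phi>"
begin

lemma extensional:
  assumes "a \<in> D (Suc n)" "b \<in> D (Suc n)" "\<And>z. z \<in> D n \<Longrightarrow> E n z a \<longleftrightarrow> E n z b"
  shows "a = b"
proof -
  obtain v where "v \<in> valuations D"
    using valuations_nonempty nonempty by blast
  moreover have "extensionality n \<in> TST"
    by (simp add: TST_def)
  ultimately have "sat D E v (extensionality n)"
    by (rule sat_TST[rotated])
  with assms show ?thesis
    by (simp add: extensionality_def)
qed

lemma ex_comprehension:
  assumes v: "v \<in> valuations D"
  shows "\<exists>a \<in> D (Suc n). \<forall>z \<in> D n. E n z a \<longleftrightarrow> sat D E (shift n z v) \<phi>"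
proof -
  obtain ts where "sentence (foldr Forall ts (comprehension n \<phi>))"
    using ex_universal_closure by blast
  then have "foldr Forall ts (comprehension n \<phi>) \<in> TST"
    unfolding TST_def by blast
  then have "sat D E v (comprehension n \<phi>)"
    using sat_TST valid_foldr_Forall[of D E ts "comprehension n \<phi>"] v by blast
  moreover have "sat D E (shift n z (shift (Suc n) a v)) (lift (Suc n) \<phi>) = sat D E (shift n z v) \<phi>"
    for z a
    unfolding lift_def sat_rename
    by (rule arg_cong2[where f = "\<lambda>w. sat D E w"])
      (auto simp: fun_eq_iff shift_def split: nat.split)
  ultimately show ?thesis
    by (simp add: comprehension_def)
qed

text \<open>Only the part of \<open>S\<close> that lies in \<open>D n\<close> matters: it has to be the extension of an object of
  type \<open>n + 1\<close>. Four instances of comprehension provide all the sets that will be needed, since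
  falsity and implication generate the Boolean operations.\<close>

definition internal :: "nat \<Rightarrow> 'a set \<Rightarrow> bool" where
  "internal n S \<longleftrightarrow> (\<exists>a \<in> D (Suc n). \<forall>z \<in> D n. E n z a \<longleftrightarrow> z \<in> S)"

lemma internal_cong: "(\<And>z. z \<in> D n \<Longrightarrow> z \<in> S \<longleftrightarrow> z \<in> T) \<Longrightarrow> internal n S = internal n T"
  by (simp add: internal_def)

lemma internal_empty: "internal n {}"
proof -
  obtain v where "v \<in> valuations D"
    using valuations_nonempty nonempty by blast
  from ex_comprehension[OF this, of n Falsum] show ?thesis
    by (simp add: internal_def)
qed

lemma internal_singleton:
  assumes "d \<in> D n"
  shows "internal n {d}"
proof -
  obtain v where "v \<in> valuations D"
    using valuations_nonempty nonempty by blast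
  then have "shift n d v \<in> valuations D"
    using assms by (simp add: shift_in_valuations)
  from ex_comprehension[OF this, of n "Eq n 0 1"] show ?thesis
    by (simp add: internal_def)
qed

lemma internal_elementhood:
  assumes "b \<in> D n"
  shows "internal (Suc n) {z. E n b z}"
proof -
  obtain v where "v \<in> valuations D"
    using valuations_nonempty nonempty by blast
  then have "shift n b v \<in> valuations D"
    using assms by (simp add: shift_in_valuations)
  from ex_comprehension[OF this, of "Suc n" "Mem n 0 0"] show ?thesis
    by (simp add: internal_def)
qed

lemma internal_Imp:
  assumes "internal n S" "internal n T"
  shows "internal n (- S \<union> T)"
proof -
  obtain a b where ab: "a \<in> D (Suc n)" "b \<in> D (Suc n)"
    "\<forall>z \<in> D n. E n z a \<longleftrightarrow> z \<in> S" "\<forall>z \<in> D n. E n z b \<longleftrightarrow> z \<in> T"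
    using assms by (auto simp: internal_def)
  obtain v where "v \<in> valuations D"
    using valuations_nonempty nonempty by blast
  then have "shift (Suc n) a (shift (Suc n) b v) \<in> valuations D"
    using ab by (simp add: shift_in_valuations)
  from ex_comprehension[OF this, of n "Imp (Mem n 0 0) (Mem n 0 1)"] ab show ?thesis
    by (simp add: internal_def)
qed

lemma internal_Compl: "internal n S \<Longrightarrow> internal n (- S)"
  using internal_Imp[OF _ internal_empty] by simp

lemma internal_Un: "internal n S \<Longrightarrow> internal n T \<Longrightarrow> internal n (S \<union> T)"
  using internal_Imp[OF internal_Compl] by simp

lemma internal_Int: "internal n S \<Longrightarrow> internal n T \<Longrightarrow> internal n (S \<inter> T)"
  using internal_Compl[OF internal_Un[OF internal_Compl internal_Compl]] by simp

lemma internal_UN: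
  "finite I \<Longrightarrow> (\<And>i. i \<in> I \<Longrightarrow> internal n (S i)) \<Longrightarrow> internal n (\<Union>i \<in> I. S i)"
  by (induction I rule: finite_induct) (simp_all add: internal_empty internal_Un)

lemma internal_INT:
  "finite I \<Longrightarrow> (\<And>i. i \<in> I \<Longrightarrow> internal n (S i)) \<Longrightarrow> internal n (\<Inter>i \<in> I. S i)"
  using internal_Compl[OF internal_UN[of I n "\<lambda>i. - S i"]] by (simp add: internal_Compl)

lemma internal_finite:
  assumes "finite S" "S \<subseteq> D n"
  shows "internal n S"
  using internal_UN[OF assms(1), of n "\<lambda>d. {d}"] assms(2) internal_singleton by auto

definition is_pair :: "nat \<Rightarrow> 'a \<Rightarrow> 'a \<Rightarrow> 'a \<Rightarrow> bool" where
  "is_pair n p a b \<longleftrightarrow> (\<forall>u \<in> D (Suc n). E (Suc n) u p \<longleftrightarrow>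
     (\<forall>z \<in> D n. E n z u \<longleftrightarrow> z = a) \<or> (\<forall>z \<in> D n. E n z u \<longleftrightarrow> z = a \<or> z = b))"

lemma sat_is_pair_fm:
  "sat D E v (is_pair_fm n p a b) \<longleftrightarrow> is_pair n (v (Suc (Suc n)) p) (v n a) (v n b)"
  by (simp add: is_pair_fm_def is_singleton_fm_def is_upair_fm_def is_pair_def)

text \<open>That a pair determines its components depends on the existence of the two sets that should be
  its elements; if they were missing, then a pair might well have no elements at all.\<close>

lemma is_pair_unique:
  assumes D: "a \<in> D n" "b \<in> D n" "a' \<in> D n" "b' \<in> D n"
    and pairs: "is_pair n p a b" "is_pair n p a' b'"
  shows "a = a' \<and> b = b'"
proof -
  define ext where "ext u = {z \<in> D n. E n z u}" for u
  have *: "{ext u |u. u \<in> D (Suc n) \<and> E (Suc n) u p} = {{c}, {c, d}}"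
    if D: "c \<in> D n" "d \<in> D n" and p: "is_pair n p c d" for c d
  proof -
    have iff: "E (Suc n) u p \<longleftrightarrow> ext u \<in> {{c}, {c, d}}" if "u \<in> D (Suc n)" for u
      using bspec[OF p[unfolded is_pair_def] that] D by (auto simp: ext_def)
    have "\<exists>u \<in> D (Suc n). ext u = S" if "S \<subseteq> D n" "finite S" for S
      using internal_finite[OF that(2,1)] that(1) by (auto simp: internal_def ext_def)
    from this[of "{c}"] this[of "{c, d}"] D
    obtain u w where "u \<in> D (Suc n)" "ext u = {c}" "w \<in> D (Suc n)" "ext w = {c, d}"
      by auto
    with iff show ?thesis by blast
  qed
  have "{{a}, {a, b}} = {{a'}, {a', b'}}"
    using *[OF D(1,2) pairs(1)] *[OF D(3,4) pairs(2)] by simp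
  then show ?thesis
    by (auto simp: doubleton_eq_iff)
qed

text \<open>In an infinite type, the traces on finitely many elements are prescribable, with infinitely
  many solutions: one element outside the finite set may be added at will.\<close>

lemma infinite_prescribed_trace:
  assumes inf: "infinite (D n)" and B: "finite B" "B \<subseteq> D n" and J: "J \<subseteq> B"
  shows "infinite {y \<in> D (Suc n). \<forall>b \<in> B. E n b y \<longleftrightarrow> b \<in> J}"
proof -
  have "\<exists>y \<in> D (Suc n). \<forall>z \<in> D n. E n z y \<longleftrightarrow> z \<in> insert d J" if "d \<in> D n - B" for d
    using internal_finite[of "insert d J" n] that B J finite_subset
    unfolding internal_def by blast
  then obtain f where f: "\<And>d. d \<in> D n - B \<Longrightarrow> f d \<in> D (Suc n)"
    "\<And>d z. d \<in> D n - B \<Longrightarrow> z \<in> D n \<Longrightarrow> E n z (f d) \<longleftrightarrow> z \<in> insert d J"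
    by metis
  have "inj_on f (D n - B)"
  proof (rule inj_onI)
    fix d e assume "d \<in> D n - B" "e \<in> D n - B" "f d = f e"
    then show "d = e"
      using f(2)[of d d] f(2)[of e d] J by auto
  qed
  moreover have "infinite (D n - B)"
    using inf B by simp
  ultimately have "infinite (f ` (D n - B))"
    using finite_imageD by blast
  moreover have "f ` (D n - B) \<subseteq> {y \<in> D (Suc n). \<forall>b \<in> B. E n b y \<longleftrightarrow> b \<in> J}"
    using f B(2) by fastforce
  ultimately show ?thesis
    using finite_subset by blast
qed

end

locale tsti_model = tst_model +
  assumes sat_infinity: "v \<in> valuations D \<Longrightarrow> sat D E v infinity"
begin

text \<open>The axiom of infinity is formulated inside the model, but the function of which it speaks is also
  a function in the metatheory: it maps the extension of its domain injectively into itself, and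
  misses a value.\<close>

lemma infinite_individuals: "infinite (D 0)"
proof -
  define maps where "maps f a b \<longleftrightarrow> (\<exists>p \<in> D 2. is_pair 0 p a b \<and> E 2 p f)" for f a b
  have sat_maps: "sat D E v (maps_to_fm 0 f a b) \<longleftrightarrow> maps (v 3 f) (v 0 a) (v 0 b)" for v f a b
    by (simp add: maps_to_fm_def sat_is_pair_fm maps_def numeral_2_eq_2 numeral_3_eq_3)
  obtain v where "v \<in> valuations D"
    using valuations_nonempty nonempty by blast
  from sat_infinity[OF this] obtain x f where
    pairs: "\<forall>p \<in> D 2. E 2 p f \<longrightarrow> (\<exists>a \<in> D 0. \<exists>b \<in> D 0. E 0 a x \<and> E 0 b x \<and> is_pair 0 p a b)"
    and total: "\<forall>a \<in> D 0. E 0 a x \<longrightarrow> (\<exists>b \<in> D 0. maps f a b \<and> (\<forall>b' \<in> D 0. maps f a b' \<longrightarrow> b' = b))"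
    and inj: "\<forall>a \<in> D 0. \<forall>b \<in> D 0. \<forall>c \<in> D 0. maps f a c \<and> maps f b c \<longrightarrow> a = b"
    and not_surj: "\<exists>c \<in> D 0. E 0 c x \<and> \<not> (\<exists>a \<in> D 0. maps f a c)"
    by (auto simp: infinity_def function_fm_def injective_fm_def surjective_fm_def sat_maps
        sat_is_pair_fm numeral_2_eq_2 numeral_3_eq_3)
  define X where "X = {a \<in> D 0. E 0 a x}"
  have in_X: "b \<in> X" if ab: "a \<in> D 0" "b \<in> D 0" "maps f a b" for a b
  proof -
    obtain p where p: "p \<in> D 2" "is_pair 0 p a b" "E 2 p f"
      using ab(3) by (auto simp: maps_def)
    with pairs obtain a' b' where "a' \<in> D 0" "b' \<in> D 0" "E 0 b' x" "is_pair 0 p a' b'"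
      by blast
    with is_pair_unique[of a 0 b a' b' p] ab p show ?thesis
      by (auto simp: X_def)
  qed
  have "\<forall>a \<in> X. \<exists>b \<in> X. maps f a b"
  proof
    fix a assume a: "a \<in> X"
    then obtain b where "b \<in> D 0" "maps f a b"
      using total unfolding X_def by blast
    with a in_X[of a b] show "\<exists>b \<in> X. maps f a b"
      unfolding X_def by blast
  qed
  then obtain F where F: "\<And>a. a \<in> X \<Longrightarrow> F a \<in> X" "\<And>a. a \<in> X \<Longrightarrow> maps f a (F a)"
    by metis
  have "inj_on F X"
    using inj F by (intro inj_onI) (metis (no_types, lifting) X_def mem_Collect_eq)
  moreover have "F ` X \<noteq> X"
  proof
    assume eq: "F ` X = X"
    obtain c where c: "c \<in> X" "\<And>a. a \<in> X \<Longrightarrow> \<not> maps f a c"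
      using not_surj unfolding X_def by blast
    with eq obtain a where "a \<in> X" "c = F a" by blast
    with F(2) c(2) show False by blast
  qed
  ultimately have "infinite X"
    using endo_inj_surj[of X F] F(1) by blast
  then show ?thesis
    by (rule contrapos_nn) (simp add: X_def)
qed

lemma infinite_type: "infinite (D n)"
proof (induction n)
  case (Suc n)
  from infinite_prescribed_trace[OF this, of "{}" "{}"] show ?case by simp
qed (fact infinite_individuals)

end


section \<open>Injections with prescribed preimages\<close>

text \<open>The sets in \<open>Y\<close> divide \<open>P\<close> into finitely many cells, so one of them is infinite. The range of \<open>g\<close>
  is chosen to consist of that cell, of \<open>X\<close>, and of one representative from each cell. It is
  countably infinite and so admits a bijection from \<open>P'\<close> which extends the inverse of \<open>h\<close>. All but
  finitely many values lie in the one infinite cell, so preimages of members of \<open>Y\<close> are finite or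
  cofinite; and because all cells are hit, members of \<open>Y\<close> that differ on \<open>P\<close> have different preimages.\<close>

lemma one_colour_injection:
  fixes P' :: "'a::countable set" and P :: "'b::countable set"
  assumes inf: "infinite P'" "infinite P"
    and X: "finite X" "X \<subseteq> P" and h: "inj_on h X" "h ` X \<subseteq> P'"
    and Y: "finite Y"
  shows "\<exists>g. inj_on g P' \<and> g ` P' \<subseteq> P \<and> (\<forall>a \<in> X. g (h a) = a) \<and>
    (\<forall>A \<in> Y. finite {y \<in> P'. g y \<in> A} \<or> finite {y \<in> P'. g y \<notin> A}) \<and>
    (\<forall>y \<in> P. \<exists>y' \<in> P'. \<forall>A \<in> Y. g y' \<in> A \<longleftrightarrow> y \<in> A)"
proof -
  define t where "t y = {A \<in> Y. y \<in> A}" for y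
  have fin: "finite (t ` P)"
    by (rule finite_subset[of _ "Pow Y"]) (use Y in \<open>auto simp: t_def\<close>)
  obtain y0 where "infinite {y \<in> P. t y = t y0}"
    using pigeonhole_infinite[OF inf(2) fin] by blast
  moreover define W where "W = X \<union> inv_into P t ` t ` P"
  moreover define Q where "Q = W \<union> {y \<in> P. t y = t y0}"
  ultimately have W: "finite W" "X \<subseteq> W" "W \<subseteq> P" and Q: "Q \<subseteq> P" "infinite Q" "X \<subseteq> Q"
    using X fin by (auto intro: inv_into_into)
  have "infinite (P' - h ` X)" "infinite (Q - X)"
    using inf Q X by simp_all
  then have "bij_betw (from_nat_into (P' - h ` X)) UNIV (P' - h ` X)"
    "bij_betw (from_nat_into (Q - X)) UNIV (Q - X)"
    by (simp_all add: bij_betw_from_nat_into)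
  then obtain k where k: "bij_betw k (P' - h ` X) (Q - X)"
    using bij_betw_inv bij_betw_trans by blast
  define g where "g y = (if y \<in> h ` X then inv_into X h y else k y)" for y
  have gh: "g (h a) = a" if "a \<in> X" for a
    using h(1) that by (simp add: g_def)
  have "bij_betw g (h ` X) X"
    using bij_betw_inv_into[OF inj_on_imp_bij_betw[OF h(1)]]
    by (rule bij_betw_cong[THEN iffD1, rotated]) (simp add: g_def)
  moreover have "bij_betw g (P' - h ` X) (Q - X)"
    using k by (rule bij_betw_cong[THEN iffD1, rotated]) (simp add: g_def)
  ultimately have "bij_betw g (h ` X \<union> (P' - h ` X)) (X \<union> (Q - X))"
    by (rule bij_betw_combine) blast
  moreover have "h ` X \<union> (P' - h ` X) = P'" "X \<union> (Q - X) = Q"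
    using h(2) Q(3) by blast+
  ultimately have g: "inj_on g P'" "g ` P' = Q"
    by (auto simp: bij_betw_def)
  have fin_W: "finite {y \<in> P'. g y \<in> W}"
  proof -
    have "finite (g -` W \<inter> P')"
      using W(1) g(1) by (rule finite_vimage_IntI)
    then show ?thesis
      by (rule finite_subset[rotated]) blast
  qed
  have "finite {y \<in> P'. g y \<in> A} \<or> finite {y \<in> P'. g y \<notin> A}" if "A \<in> Y" for A
  proof -
    have "g y \<in> W \<or> (g y \<in> A \<longleftrightarrow> A \<in> t y0)" if "y \<in> P'" for y
      using g(2) that \<open>A \<in> Y\<close> by (auto simp: Q_def t_def)
    then have "{y \<in> P'. g y \<in> A} \<subseteq> {y \<in> P'. g y \<in> W} \<or> {y \<in> P'. g y \<notin> A} \<subseteq> {y \<in> P'. g y \<in> W}"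
      by blast
    then show ?thesis
      using fin_W finite_subset by blast
  qed
  moreover have "\<exists>y' \<in> P'. \<forall>A \<in> Y. g y' \<in> A \<longleftrightarrow> y \<in> A" if "y \<in> P" for y
  proof -
    define w where "w = inv_into P t (t y)"
    have "t w = t y"
      using that by (simp add: w_def f_inv_into_f)
    moreover have "w \<in> g ` P'"
      using that g(2) by (auto simp: w_def Q_def W_def)
    ultimately show ?thesis
      by (auto simp: t_def)
  qed
  ultimately show ?thesis
    using g gh Q(1) by blast
qed

text \<open>The injections obtained for the single colours combine to one that preserves colours.\<close>

lemma coloured_injection:
  fixes P' :: "'a::countable set" and P :: "'b::countable set"
    and c' :: "'a \<Rightarrow> 'c" and c :: "'b \<Rightarrow> 'c"
  assumes inf: "\<And>k. k \<in> C \<Longrightarrow> infinite {y \<in> P'. c' y = k}" "\<And>k. k \<in> C \<Longrightarrow> infinite {y \<in> P. c y = k}"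
    and C: "c' ` P' \<subseteq> C" "c ` P \<subseteq> C"
    and X: "finite X" "X \<subseteq> P" and h: "inj_on h X" "h ` X \<subseteq> P'" "\<And>a. a \<in> X \<Longrightarrow> c' (h a) = c a"
    and Y: "finite Y"
  shows "\<exists>g. inj_on g P' \<and> g ` P' \<subseteq> P \<and> (\<forall>a \<in> X. g (h a) = a) \<and>
    (\<forall>y \<in> P'. c (g y) = c' y) \<and>
    (\<forall>A \<in> Y. \<forall>k \<in> C.
      finite {y \<in> P'. c' y = k \<and> g y \<in> A} \<or> finite {y \<in> P'. c' y = k \<and> g y \<notin> A}) \<and>
    (\<forall>y \<in> P. \<exists>y' \<in> P'. \<forall>A \<in> Y. g y' \<in> A \<longleftrightarrow> y \<in> A)"
proof -
  define P'' where "P'' k = {y \<in> P'. c' y = k}" for k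
  define Q where "Q k = {y \<in> P. c y = k}" for k
  have "\<forall>k \<in> C. \<exists>g. inj_on g (P'' k) \<and> g ` P'' k \<subseteq> Q k \<and> (\<forall>a \<in> X \<inter> Q k. g (h a) = a) \<and>
    (\<forall>A \<in> Y. finite {y \<in> P'' k. g y \<in> A} \<or> finite {y \<in> P'' k. g y \<notin> A}) \<and>
    (\<forall>y \<in> Q k. \<exists>y' \<in> P'' k. \<forall>A \<in> Y. g y' \<in> A \<longleftrightarrow> y \<in> A)"
  proof
    fix k assume "k \<in> C"
    then show "\<exists>g. inj_on g (P'' k) \<and> g ` P'' k \<subseteq> Q k \<and> (\<forall>a \<in> X \<inter> Q k. g (h a) = a) \<and>
      (\<forall>A \<in> Y. finite {y \<in> P'' k. g y \<in> A} \<or> finite {y \<in> P'' k. g y \<notin> A}) \<and>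
      (\<forall>y \<in> Q k. \<exists>y' \<in> P'' k. \<forall>A \<in> Y. g y' \<in> A \<longleftrightarrow> y \<in> A)"
      using inf X h Y unfolding P''_def Q_def
      by (intro one_colour_injection) (auto intro: inj_on_subset)
  qed
  from bchoice[OF this] obtain G where
    "\<forall>k \<in> C. inj_on (G k) (P'' k) \<and> G k ` P'' k \<subseteq> Q k \<and> (\<forall>a \<in> X \<inter> Q k. G k (h a) = a) \<and>
      (\<forall>A \<in> Y. finite {y \<in> P'' k. G k y \<in> A} \<or> finite {y \<in> P'' k. G k y \<notin> A}) \<and>
      (\<forall>y \<in> Q k. \<exists>y' \<in> P'' k. \<forall>A \<in> Y. G k y' \<in> A \<longleftrightarrow> y \<in> A)" ..
  then have G: "inj_on (G k) (P'' k)" "G k ` P'' k \<subseteq> Q k"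
    "\<And>a. a \<in> X \<inter> Q k \<Longrightarrow> G k (h a) = a"
    "\<And>A. A \<in> Y \<Longrightarrow> finite {y \<in> P'' k. G k y \<in> A} \<or> finite {y \<in> P'' k. G k y \<notin> A}"
    "\<And>y. y \<in> Q k \<Longrightarrow> \<exists>y' \<in> P'' k. \<forall>A \<in> Y. G k y' \<in> A \<longleftrightarrow> y \<in> A"
    if "k \<in> C" for k
    using that by simp_all
  define g where "g y = G (c' y) y" for y
  have g_in: "g y \<in> Q (c' y)" if "y \<in> P'" for y
    using G(2)[of "c' y"] C(1) that by (auto simp: g_def P''_def)
  then have colour: "c (g y) = c' y" if "y \<in> P'" for y
    using that by (auto simp: Q_def)
  show ?thesis
  proof (intro exI[of _ g] conjI ballI)
    show "inj_on g P'"
    proof (rule inj_onI)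
      fix y z assume yz: "y \<in> P'" "z \<in> P'" "g y = g z"
      then have "c' y = c' z" using colour by metis
      with yz show "y = z"
        using inj_onD[OF G(1)[of "c' y"], of y z] C(1) by (auto simp: g_def P''_def)
    qed
    show "g ` P' \<subseteq> P"
      using g_in by (auto simp: Q_def)
    show "g (h a) = a" if "a \<in> X" for a
      using G(3)[of "c a" a] C(2) X(2) h(3) that by (auto simp: g_def Q_def)
    show "finite {y \<in> P'. c' y = k \<and> g y \<in> A} \<or> finite {y \<in> P'. c' y = k \<and> g y \<notin> A}"
      if "A \<in> Y" "k \<in> C" for A k
    proof -
      have "{y \<in> P'. c' y = k \<and> g y \<in> A} = {y \<in> P'' k. G k y \<in> A}"
        "{y \<in> P'. c' y = k \<and> g y \<notin> A} = {y \<in> P'' k. G k y \<notin> A}"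
        by (auto simp: g_def P''_def)
      then show ?thesis using G(4)[OF that(2,1)] by simp
    qed
    show "\<exists>y' \<in> P'. \<forall>A \<in> Y. g y' \<in> A \<longleftrightarrow> y \<in> A" if "y \<in> P" for y
    proof -
      have "c y \<in> C" "y \<in> Q (c y)"
        using C(2) that by (auto simp: Q_def)
      from G(5)[OF this] obtain y' where "y' \<in> P'' (c y)" "\<forall>A \<in> Y. G (c y) y' \<in> A \<longleftrightarrow> y \<in> A"
        ..
      then show ?thesis
        by (intro bexI[of _ y']) (simp_all add: P''_def g_def)
    qed
    show "c (g y) = c' y" if "y \<in> P'" for y
      using colour[OF that] .
  qed
qed


section \<open>Transfer between two models\<close>

lemma quantifier_free_transfer:
  assumes eq: "\<And>n a a' b b'. R n a a' \<Longrightarrow> R n b b' \<Longrightarrow> a = b \<longleftrightarrow> a' = b'"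
    and mem: "\<And>n a a' b b'. R n a a' \<Longrightarrow> R (Suc n) b b' \<Longrightarrow> E n a b \<longleftrightarrow> E' n a' b'"
  shows "quantifier_free \<theta> \<Longrightarrow> (\<And>n i. (n, i) \<in> free_vars \<theta> \<Longrightarrow> R n (v n i) (w n i)) \<Longrightarrow>
    sat D E v \<theta> \<longleftrightarrow> sat D' E' w \<theta>"
proof (induction \<theta>)
  case (Imp \<phi> \<psi>)
  then have "sat D E v \<phi> \<longleftrightarrow> sat D' E' w \<phi>" "sat D E v \<psi> \<longleftrightarrow> sat D' E' w \<psi>"
    by simp_all
  then show ?case by simp
next
  case (Eq n i j)
  then show ?case using eq[of n "v n i" "w n i" "v n j" "w n j"] by simp
next
  case (Mem n i j)
  then show ?case using mem[of n "v n i" "w n i" "v (Suc n) j" "w (Suc n) j"] by simp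
qed simp_all

text \<open>A witness of type \<open>s\<close> is moved along the relation, which still respects equality and membership
  for the extended valuations; so totality of the relation at type \<open>s\<close> suffices, and only in one
  direction.\<close>

lemma existential_transfer:
  assumes eq: "\<And>n a a' b b'. R n a a' \<Longrightarrow> R n b b' \<Longrightarrow> a = b \<longleftrightarrow> a' = b'"
    and mem: "\<And>n a a' b b'. R n a a' \<Longrightarrow> R (Suc n) b b' \<Longrightarrow> E n a b \<longleftrightarrow> E' n a' b'"
    and witness: "\<And>a. a \<in> D s \<Longrightarrow> \<exists>a' \<in> D' s. R s a a'"
    and qf: "quantifier_free \<theta>"
  shows "(\<And>n i. (n, i) \<in> free_vars ((Exists s ^^ l) \<theta>) \<Longrightarrow> R n (v n i) (w n i)) \<Longrightarrow>
    sat D E v ((Exists s ^^ l) \<theta>) \<Longrightarrow> sat D' E' w ((Exists s ^^ l) \<theta>)"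
proof (induction l arbitrary: v w)
  case 0
  then show ?case
    using quantifier_free_transfer[of R E E' \<theta> v w D D', OF eq mem qf] by simp
next
  case (Suc l)
  let ?\<psi> = "(Exists s ^^ l) \<theta>"
  obtain a where a: "a \<in> D s" "sat D E (shift s a v) ?\<psi>"
    using Suc.prems(2) by auto
  obtain a' where a': "a' \<in> D' s" "R s a a'"
    using witness[OF a(1)] by blast
  have "R n (shift s a v n i) (shift s a' w n i)" if "(n, i) \<in> free_vars ?\<psi>" for n i
  proof (cases "n = s \<and> i = 0")
    case False
    then have "(n, if n = s then i - 1 else i) \<in> free_vars ((Exists s ^^ Suc l) \<theta>)"
      using that by (auto simp: Exists_def Neg_def)
    from Suc.prems(1)[OF this] False show ?thesis
      by (auto simp: shift_def split: nat.split)
  qed (use a' in simp)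
  from Suc.IH[OF this a(2)] a'(1) show ?case by auto
qed

text \<open>At type 0 there are no elements to be had, and the empty set is the only trace.\<close>

definition trace :: "(nat \<Rightarrow> 'b \<Rightarrow> 'b \<Rightarrow> bool) \<Rightarrow> (nat \<Rightarrow> 'b set) \<Rightarrow> nat \<Rightarrow> 'b \<Rightarrow> 'b set" where
  "trace E X n a = (case n of 0 \<Rightarrow> {} | Suc m \<Rightarrow> {b \<in> X m. E m b a})"

definition traces :: "(nat \<Rightarrow> 'b set) \<Rightarrow> nat \<Rightarrow> 'b set set" where
  "traces X n = (case n of 0 \<Rightarrow> {{}} | Suc m \<Rightarrow> Pow (X m))"

lemma trace_in_traces: "trace E X n a \<in> traces X n"
  by (auto simp: trace_def traces_def split: nat.split)

lemma (in tsti_model) infinite_trace_class: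
  assumes X: "\<And>n. finite (X n)" "\<And>n. X n \<subseteq> D n" and J: "J \<in> traces X n"
  shows "infinite {a \<in> D n. trace E X n a = J}"
proof (cases n)
  case 0
  then show ?thesis
    using J infinite_type[of 0] by (simp add: trace_def traces_def)
next
  case (Suc m)
  then have "J \<subseteq> X m"
    using J by (simp add: traces_def)
  moreover from this have "{a \<in> D n. trace E X n a = J} = {a \<in> D (Suc m). \<forall>b \<in> X m. E m b a \<longleftrightarrow> b \<in> J}"
    by (auto simp: trace_def Suc)
  ultimately show ?thesis
    using infinite_prescribed_trace[OF infinite_type X(1) X(2)] by simp
qed

text \<open>The finite sets \<open>X n\<close> contain the objects of the second model that are to be copied into the
  first one.\<close>

locale two_models = M: tsti_model D E + N: tsti_model D' E'
  for D :: "nat \<Rightarrow> 'a::countable set" and E and D' :: "nat \<Rightarrow> 'b::countable set" and E' +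
  fixes X :: "nat \<Rightarrow> 'b set"
  assumes finite_X: "finite (X n)" and X_subset: "X n \<subseteq> D' n"
begin

text \<open>The state of the recursion at type \<open>n\<close>: the map \<open>h\<close> copies \<open>X n\<close> into the first model, and \<open>c y\<close> is
  the trace of an object \<open>y\<close> of the first model on the copies made at the preceding type, expressed
  in terms of the originals. Recording \<open>c\<close> instead of the preceding copies makes type 0 an
  instance, where nothing precedes.\<close>

definition level :: "nat \<Rightarrow> ('a \<Rightarrow> 'b set) \<Rightarrow> ('b \<Rightarrow> 'a) \<Rightarrow> bool" where
  "level n c h \<longleftrightarrow> inj_on h (X n) \<and> h ` X n \<subseteq> D n \<and> (\<forall>a \<in> X n. c (h a) = trace E' X n a) \<and>
     c ` D n \<subseteq> traces X n \<and>
     (\<forall>J \<in> traces X n. infinite {y \<in> D n. c y = J} \<and> M.internal n {y. c y = J})"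

text \<open>The relation of a state \<open>(c, h)\<close> to its successor \<open>(c', h')\<close>: the map \<open>g\<close> sends the first model back
  to the second one at type \<open>n\<close>, and \<open>h'\<close> copies a set to its preimage under \<open>g\<close>.\<close>

definition linked ::
  "nat \<Rightarrow> ('a \<Rightarrow> 'b set) \<Rightarrow> ('b \<Rightarrow> 'a) \<Rightarrow> ('a \<Rightarrow> 'b set) \<Rightarrow> ('b \<Rightarrow> 'a) \<Rightarrow> ('a \<Rightarrow> 'b) \<Rightarrow> bool" where
  "linked n c h c' h' g \<longleftrightarrow> inj_on g (D n) \<and> g ` D n \<subseteq> D' n \<and> (\<forall>a \<in> X n. g (h a) = a) \<and>
     (\<forall>y \<in> D n. trace E' X n (g y) = c y) \<and>
     (\<forall>y \<in> D n. \<forall>A \<in> X (Suc n). E n y (h' A) \<longleftrightarrow> E' n (g y) A) \<and>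
     c' = (\<lambda>y. {b \<in> X n. E n (h b) y})"

lemma ex_level_0: "\<exists>c h. level 0 c h"
proof -
  obtain S where S: "S \<subseteq> D 0" "finite S" "card S = card (X 0)"
    using infinite_arbitrarily_large[OF M.infinite_type] by blast
  then obtain h where "bij_betw h (X 0) S"
    using finite_same_card_bij[OF finite_X] by metis
  moreover have "M.internal 0 UNIV"
    using M.internal_Compl[OF M.internal_empty] by simp
  ultimately have "level 0 (\<lambda>_. {}) h"
    using S(1) M.infinite_type[of 0]
    by (auto simp: level_def trace_def traces_def bij_betw_def)
  then show ?thesis by blast
qed

text \<open>A map \<open>g\<close> which respects traces, and for which the preimages of the members of \<open>X (n + 1)\<close> are
  finite or cofinite for each trace, is given by \<open>coloured_injection\<close>. The preimages are then
  Boolean combinations of finite sets and of the sets of objects with a given trace, so they are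
  sets of the first model. Those of different members of \<open>X (n + 1)\<close> are different, because \<open>g\<close>
  meets every cell, and in the second model different sets are told apart by an element.\<close>

lemma ex_next_level:
  assumes level: "level n c h"
  shows "\<exists>c' h' g. level (Suc n) c' h' \<and> linked n c h c' h' g"
proof -
  have h: "inj_on h (X n)" "h ` X n \<subseteq> D n" "\<And>a. a \<in> X n \<Longrightarrow> c (h a) = trace E' X n a"
    and c: "c ` D n \<subseteq> traces X n"
    and J: "\<And>J. J \<in> traces X n \<Longrightarrow> infinite {y \<in> D n. c y = J}"
      "\<And>J. J \<in> traces X n \<Longrightarrow> M.internal n {y. c y = J}"
    using level by (simp_all add: level_def)
  let ?Y = "(\<lambda>A. {z. E' n z A}) ` X (Suc n)"
  have "\<exists>g. inj_on g (D n) \<and> g ` D n \<subseteq> D' n \<and> (\<forall>a \<in> X n. g (h a) = a) \<and>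
    (\<forall>y \<in> D n. trace E' X n (g y) = c y) \<and>
    (\<forall>B \<in> ?Y. \<forall>J \<in> traces X n.
      finite {y \<in> D n. c y = J \<and> g y \<in> B} \<or> finite {y \<in> D n. c y = J \<and> g y \<notin> B}) \<and>
    (\<forall>z \<in> D' n. \<exists>y \<in> D n. \<forall>B \<in> ?Y. g y \<in> B \<longleftrightarrow> z \<in> B)"
  proof (rule coloured_injection)
    show "infinite {z \<in> D' n. trace E' X n z = J}" if "J \<in> traces X n" for J
      using N.infinite_trace_class[OF finite_X X_subset that] .
    show "trace E' X n ` D' n \<subseteq> traces X n"
      by (simp add: image_subset_iff trace_in_traces)
  qed (use J(1) h c finite_X X_subset in auto)
  then obtain g where g: "inj_on g (D n)" "g ` D n \<subseteq> D' n" "\<forall>a \<in> X n. g (h a) = a"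
    "\<forall>y \<in> D n. trace E' X n (g y) = c y"
    and cofinite: "\<forall>B \<in> ?Y. \<forall>J \<in> traces X n.
      finite {y \<in> D n. c y = J \<and> g y \<in> B} \<or> finite {y \<in> D n. c y = J \<and> g y \<notin> B}"
    and hits: "\<forall>z \<in> D' n. \<exists>y \<in> D n. \<forall>B \<in> ?Y. g y \<in> B \<longleftrightarrow> z \<in> B"
    by (elim exE conjE) (rule that)
  have "M.internal n {y. E' n (g y) A}" if A: "A \<in> X (Suc n)" for A
  proof -
    have "M.internal n {y \<in> D n. c y = J \<and> E' n (g y) A}" if "J \<in> traces X n" for J
    proof (cases "finite {y \<in> D n. c y = J \<and> E' n (g y) A}")
      case True
      then show ?thesis by (rule M.internal_finite) blast
    next
      case False
      then have "finite {y \<in> D n. c y = J \<and> \<not> E' n (g y) A}"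
        using bspec[OF bspec[OF cofinite imageI[OF A]] that] by simp
      then have "M.internal n {y \<in> D n. c y = J \<and> \<not> E' n (g y) A}"
        by (rule M.internal_finite) blast
      from M.internal_Int[OF J(2)[OF that] M.internal_Compl[OF this]] show ?thesis
        by (rule M.internal_cong[THEN iffD1, rotated]) auto
    qed
    moreover have "finite (traces X n)"
      using finite_X by (simp add: traces_def split: nat.split)
    ultimately have "M.internal n (\<Union>J \<in> traces X n. {y \<in> D n. c y = J \<and> E' n (g y) A})"
      by (intro M.internal_UN)
    then show ?thesis
      by (rule M.internal_cong[THEN iffD1, rotated]) (use c in auto)
  qed
  then have "\<forall>A \<in> X (Suc n). \<exists>a \<in> D (Suc n). \<forall>y \<in> D n. E n y a \<longleftrightarrow> E' n (g y) A"
    by (simp add: M.internal_def)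
  then obtain h' where h': "\<And>A. A \<in> X (Suc n) \<Longrightarrow> h' A \<in> D (Suc n)"
    "\<And>A y. A \<in> X (Suc n) \<Longrightarrow> y \<in> D n \<Longrightarrow> E n y (h' A) \<longleftrightarrow> E' n (g y) A"
    by metis
  define c' where "c' y = {b \<in> X n. E n (h b) y}" for y
  have "inj_on h' (X (Suc n))"
  proof (rule inj_onI)
    fix A B assume AB: "A \<in> X (Suc n)" "B \<in> X (Suc n)" "h' A = h' B"
    show "A = B"
    proof (rule N.extensional)
      show "A \<in> D' (Suc n)" "B \<in> D' (Suc n)"
        using AB X_subset by blast+
      fix z assume "z \<in> D' n"
      then obtain y where y: "y \<in> D n" "\<And>C. C \<in> X (Suc n) \<Longrightarrow> E' n (g y) C \<longleftrightarrow> E' n z C"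
        using hits by force
      then show "E' n z A \<longleftrightarrow> E' n z B"
        using AB h'(2)[of A y] h'(2)[of B y] by simp
    qed
  qed
  moreover have "c' (h' A) = trace E' X (Suc n) A" if "A \<in> X (Suc n)" for A
    using h'(2)[OF that] h(2) g(3) by (auto simp: c'_def trace_def)
  moreover have "c' ` D (Suc n) \<subseteq> traces X (Suc n)"
    by (auto simp: c'_def traces_def)
  moreover have "infinite {y \<in> D (Suc n). c' y = J} \<and> M.internal (Suc n) {y. c' y = J}"
    if "J \<in> traces X (Suc n)" for J
  proof
    have J: "J \<subseteq> X n"
      using that by (simp add: traces_def)
    then have eq: "c' y = J \<longleftrightarrow> (\<forall>b \<in> X n. E n (h b) y \<longleftrightarrow> b \<in> J)" for y
      by (auto simp: c'_def)
    have "h b \<in> h ` J \<longleftrightarrow> b \<in> J" if "b \<in> X n" for b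
      using inj_on_image_mem_iff[OF h(1) that J] .
    then have "{y \<in> D (Suc n). c' y = J} = {y \<in> D (Suc n). \<forall>b \<in> h ` X n. E n b y \<longleftrightarrow> b \<in> h ` J}"
      by (simp add: eq)
    then show "infinite {y \<in> D (Suc n). c' y = J}"
      using M.infinite_prescribed_trace[OF M.infinite_type _ h(2) image_mono[OF J]] finite_X
      by simp
    have "M.internal (Suc n) (if b \<in> J then {y. E n (h b) y} else - {y. E n (h b) y})" if "b \<in> X n" for b
      using h(2) that by (auto intro!: M.internal_Compl M.internal_elementhood)
    then have "M.internal (Suc n) (\<Inter>b \<in> X n. if b \<in> J then {y. E n (h b) y} else - {y. E n (h b) y})"
      by (intro M.internal_INT finite_X)
    then show "M.internal (Suc n) {y. c' y = J}"
      by (rule M.internal_cong[THEN iffD1, rotated]) (auto simp: eq split: if_splits)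
  qed
  ultimately have "level (Suc n) c' h'"
    using h'(1) by (auto simp: level_def)
  moreover have "linked n c h c' h' g"
    using g h'(2) unfolding linked_def c'_def by blast
  ultimately show ?thesis by blast
qed

text \<open>The two membership conditions are the two readings of \<open>linked\<close>: membership in copied sets is
  preserved as these are preimages, and membership of copied elements is preserved because \<open>g\<close>
  respects traces.\<close>

lemma ex_approximation:
  obtains h g where "\<And>n. h n ` X n \<subseteq> D n" "\<And>n. inj_on (g n) (D n)" "\<And>n. g n ` D n \<subseteq> D' n"
    "\<And>n a. a \<in> X n \<Longrightarrow> g n (h n a) = a"
    "\<And>n y A. y \<in> D n \<Longrightarrow> A \<in> X (Suc n) \<Longrightarrow> E n y (h (Suc n) A) \<longleftrightarrow> E' n (g n y) A"
    "\<And>n b y. b \<in> X n \<Longrightarrow> y \<in> D (Suc n) \<Longrightarrow> E n (h n b) y \<longleftrightarrow> E' n b (g (Suc n) y)"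
proof -
  have "\<exists>p. \<forall>n. level n (fst (p n)) (snd (p n)) \<and>
      (\<exists>g. linked n (fst (p n)) (snd (p n)) (fst (p (Suc n))) (snd (p (Suc n))) g)"
    by (rule dependent_nat_choice) (use ex_level_0 ex_next_level in fastforce)+
  then obtain p where p: "\<And>n. level n (fst (p n)) (snd (p n))"
    "\<And>n. \<exists>g. linked n (fst (p n)) (snd (p n)) (fst (p (Suc n))) (snd (p (Suc n))) g"
    by blast
  then obtain g where g: "\<And>n. linked n (fst (p n)) (snd (p n)) (fst (p (Suc n))) (snd (p (Suc n))) (g n)"
    by metis
  show thesis
  proof (rule that[of "\<lambda>n. snd (p n)" g])
    fix n b y assume b: "b \<in> X n" and y: "y \<in> D (Suc n)"
    have "{b \<in> X n. E' n b (g (Suc n) y)} = fst (p (Suc n)) y"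
      using g[of "Suc n"] y by (simp add: linked_def trace_def)
    also have "\<dots> = {b \<in> X n. E n (snd (p n) b) y}"
      using g[of n] by (simp add: linked_def)
    finally show "E n (snd (p n) b) y \<longleftrightarrow> E' n b (g (Suc n) y)"
      using b by blast
  qed (use p(1) g in \<open>simp_all add: level_def linked_def\<close>)
qed

end

text \<open>The relation to which \<open>existential_transfer\<close> is applied is the inverse of \<open>h\<close> at all types but
  \<open>s\<close>, and the graph of \<open>g\<close> at type \<open>s\<close>, where witnesses have to be moved. Since \<open>g\<close> is left inverse to
  \<open>h\<close>, the former is contained in the graph of \<open>g\<close>. Of two adjacent types, at least one is different
  from \<open>s\<close>, so in each membership at least one side is a copied object.\<close>

lemma existential_transfer_models:
  fixes D :: "nat \<Rightarrow> 'a::countable set" and D' :: "nat \<Rightarrow> 'b::countable set"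
  assumes M: "tsti_model D E" and N: "tsti_model D' E'"
    and qf: "quantifier_free \<theta>"
    and valid: "\<forall>v \<in> valuations D. sat D E v ((Exists s ^^ l) \<theta>)"
    and w: "w \<in> valuations D'"
  shows "sat D' E' w ((Exists s ^^ l) \<theta>)"
proof -
  let ?\<psi> = "(Exists s ^^ l) \<theta>"
  define X where "X n = w n ` {i. (n, i) \<in> free_vars ?\<psi>}" for n
  interpret M: tsti_model D E by (fact M)
  interpret two_models D E D' E' X
  proof (intro two_models.intro two_models_axioms.intro M N)
    fix n
    have "finite {i. (n, i) \<in> free_vars ?\<psi>}"
      by (rule finite_subset[of _ "snd ` free_vars ?\<psi>"]) force+
    then show "finite (X n)" by (simp add: X_def)
    show "X n \<subseteq> D' n" using w by (auto simp: X_def valuations_def)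
  qed
  obtain h g where h: "\<And>n. h n ` X n \<subseteq> D n"
    and g: "\<And>n. inj_on (g n) (D n)" "\<And>n. g n ` D n \<subseteq> D' n"
    and gh: "\<And>n a. a \<in> X n \<Longrightarrow> g n (h n a) = a"
    and up: "\<And>n y A. y \<in> D n \<Longrightarrow> A \<in> X (Suc n) \<Longrightarrow> E n y (h (Suc n) A) \<longleftrightarrow> E' n (g n y) A"
    and down: "\<And>n b y. b \<in> X n \<Longrightarrow> y \<in> D (Suc n) \<Longrightarrow> E n (h n b) y \<longleftrightarrow> E' n b (g (Suc n) y)"
    using ex_approximation by blast
  define R where "R n a a' \<longleftrightarrow> a \<in> D n \<and> a' = g n a \<and> (n = s \<or> a \<in> h n ` X n)" for n a a'
  (* Valuations are total, so v needs default values of the right types. *)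
  obtain v0 where v0: "v0 \<in> valuations D"
    using valuations_nonempty M.nonempty by blast
  define v where "v n i = (if (n, i) \<in> free_vars ?\<psi> then h n (w n i) else v0 n i)" for n i
  have v_in: "h n (w n i) \<in> h n ` X n" if "(n, i) \<in> free_vars ?\<psi>" for n i
    using that by (auto simp: X_def)
  have "v \<in> valuations D"
    using v0 subsetD[OF h v_in] by (auto simp: v_def valuations_def)
  then have sat: "sat D E v ?\<psi>"
    using valid by blast
  have related: "R n (v n i) (w n i)" if "(n, i) \<in> free_vars ?\<psi>" for n i
    using v_in[OF that] h[of n] gh[of "w n i" n] that by (auto simp: R_def v_def X_def)
  show ?thesis
  proof (rule existential_transfer[where R = R, OF _ _ _ qf related sat])
    show "a = b \<longleftrightarrow> a' = b'" if "R n a a'" "R n b b'" for n a a' b b'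
      using that g(1)[of n] by (auto simp: R_def dest: inj_onD)
    show "\<exists>a' \<in> D' s. R s a a'" if "a \<in> D s" for a
      using that g(2) by (auto simp: R_def)
    show "E n a b \<longleftrightarrow> E' n a' b'" if R: "R n a a'" "R (Suc n) b b'" for n a a' b b'
    proof (cases "b \<in> h (Suc n) ` X (Suc n)")
      case True
      then show ?thesis
        using R up[of a n] gh[of _ "Suc n"] by (auto simp: R_def)
    next
      case False
      then have "a \<in> h n ` X n"
        using R by (auto simp: R_def)
      then show ?thesis
        using R down[of _ n b] gh[of _ n] by (auto simp: R_def)
    qed
  qed
qed

lemma sentence_TSTI: "\<forall>\<phi> \<in> TSTI. sentence \<phi>"
proof -
  have "sentence (extensionality n)" for n
    by (auto simp: sentence_def extensionality_def Iff_def Conj_def Neg_def split: if_splits)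
  moreover have "sentence infinity"
    by (auto simp: sentence_def infinity_def function_fm_def injective_fm_def surjective_fm_def
        maps_to_fm_def is_pair_fm_def is_singleton_fm_def is_upair_fm_def
        Iff_def Conj_def Disj_def Exists_def Neg_def split: if_splits)
  ultimately show ?thesis
    by (auto simp: TSTI_def TST_def)
qed

lemma ex_tsti_model:
  assumes "sentence \<phi>" "\<not> insert \<phi> TSTI \<turnstile> Falsum"
  obtains D :: "nat \<Rightarrow> nat set" and E where "tsti_model D E" "\<And>v. sat D E v \<phi>"
proof -
  have "\<forall>\<psi> \<in> insert \<phi> TSTI. sentence \<psi>"
    using sentence_TSTI assms(1) by blast
  from model_existence[OF this assms(2)] obtain D :: "nat \<Rightarrow> nat set" and E
    where DE: "\<And>n. D n \<noteq> {}" "\<And>\<psi> v. \<psi> \<in> insert \<phi> TSTI \<Longrightarrow> sat D E v \<psi>"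
    by blast
  have "tsti_model D E"
    by unfold_locales (use DE in \<open>auto simp: TSTI_def\<close>)
  then show thesis
    using that DE(2) by blast
qed

theorem corollary4p19:
  fixes rs :: "nat list" and s l :: nat and \<theta> \<phi> :: fm
  assumes "quantifier_free \<theta>"
    and "\<phi> = foldr Forall rs ((Exists s ^^ l) \<theta>)"
    and "sentence \<phi>"
  shows "TSTI \<turnstile> \<phi> \<or> TSTI \<turnstile> Neg \<phi>"
proof (rule ccontr)
  assume "\<not> (TSTI \<turnstile> \<phi> \<or> TSTI \<turnstile> Neg \<phi>)"
  then have con: "\<not> insert \<phi> TSTI \<turnstile> Falsum" "\<not> insert (Neg \<phi>) TSTI \<turnstile> Falsum"
    using provable_Neg_iff provable.raa by blast+
  have "sentence (Neg \<phi>)"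
    using assms(3) by (simp add: sentence_def Neg_def)
  from ex_tsti_model[OF this con(2)] obtain D' :: "nat \<Rightarrow> nat set" and E'
    where N: "tsti_model D' E'" "\<And>v. sat D' E' v (Neg \<phi>)"
    by blast
  obtain D :: "nat \<Rightarrow> nat set" and E where M: "tsti_model D E" "\<And>v. sat D E v \<phi>"
    using ex_tsti_model[OF assms(3) con(1)] by blast
  have "\<forall>v \<in> valuations D. sat D E v ((Exists s ^^ l) \<theta>)"
    using M(2) valid_foldr_Forall[of D E rs "(Exists s ^^ l) \<theta>"] assms(2) by simp
  then have "\<forall>w \<in> valuations D'. sat D' E' w ((Exists s ^^ l) \<theta>)"
    using existential_transfer_models[OF M(1) N(1) assms(1)] by blast
  then have "\<forall>w \<in> valuations D'. sat D' E' w \<phi>"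
    using valid_foldr_Forall[of D' E' rs "(Exists s ^^ l) \<theta>"] assms(2) by simp
  moreover obtain w where "w \<in> valuations D'"
    using valuations_nonempty[of D'] tst_model.nonempty[OF tsti_model.axioms(1)[OF N(1)]] by blast
  ultimately show False
    using N(2) by simp
qed

end
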